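(* Let $G$ be a graph and let $k\in\mathbb{Z}^+$ be even. Then $G$ embeds as an induced subgraph into a graph $G'$ with metamour period $k$. In addition, we can achieve $|V(G')|=|V(G)|+4$ for $k=2$ and $|V(G')|=|V(G)|+2^k-2$ for $k\ge 4$.
   Context: All graphs are finite and simple with nonempty vertex set. The metamour graph $\operatorname{M}(G)$ has vertex set $V(G)$, with $x,y$ adjacent iff $d_G(x,y)=2$ (graph distance); $\operatorname{M}^0(G)=G$ and $\operatorname{M}^{k+1}(G)=\operatorname{M}(\operatorname{M}^k(G))$. $G$ has metamour period $k\in\mathbb{Z}^+$ if $\operatorname{M}^k(G)=G$ (equality as labeled graphs) and $k$ is the minimal positive integer with this property. *)

theory Defs
  imports
    "Graph_Theory.Pair_Digraph"
    "Graph_Theory.Digraph_Isomorphism"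
    "Graph_Theory.Shortest_Path"
begin

text \<open>
  A finite simple graph is a \<^locale>\<open>pair_graph\<close>: finitely many vertices, and a symmetric
  irreflexive set of arcs, each edge \<open>{x, y}\<close> being represented by the two arcs \<open>(x, y)\<close> and
  \<open>(y, x)\<close>. This allows the null graph, so nonemptiness of the vertex set has to be
  assumed separately.
\<close>

text \<open>
  The graph distance is the shortest-path cost for unit arc weights; it is \<open>\<infinity>\<close> for
  vertices in different components.
\<close>

definition graph_dist :: "'a pair_pre_digraph \<Rightarrow> 'a \<Rightarrow> 'a \<Rightarrow> ereal" where
  "graph_dist G x y = wf_digraph.\<mu> (with_proj G) (\<lambda>_. 1) x y"

definition metamour :: "'a pair_pre_digraph \<Rightarrow> 'a pair_pre_digraph" where
  "metamour G =
    \<lparr> pverts = pverts G,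
      parcs = {(x, y). x \<in> pverts G \<and> y \<in> pverts G \<and> graph_dist G x y = 2} \<rparr>"

text \<open>Equality of records is equality of labelled graphs, not isomorphism.\<close>

definition has_metamour_period :: "'a pair_pre_digraph \<Rightarrow> nat \<Rightarrow> bool" where
  "has_metamour_period G k \<longleftrightarrow>
    k > 0 \<and> (metamour ^^ k) G = G \<and> (\<forall>j. 0 < j \<and> j < k \<longrightarrow> (metamour ^^ j) G \<noteq> G)"

definition embeds_as_induced_subgraph ::
  "'a pair_pre_digraph \<Rightarrow> 'b pair_pre_digraph \<Rightarrow> bool" where
  "embeds_as_induced_subgraph G G' \<longleftrightarrow>
    (\<exists>H. induced_subgraph H (with_proj G') \<and> digraph_iso (with_proj G) H)"

end

theory Submission
  imports Defs
begin

text \<open>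
  For an odd \<open>n\<close>, two distinct vertices of the cycle \<open>C\<^sub>n\<close> with \<open>n \<ge> 5\<close> are at distance 2 iff
  their positions differ by \<open>2\<close> or \<open>-2\<close>. So the metamour graph of the cycle is the cycle with
  step 2 on the same vertices, and iterating yields the cycles with steps \<open>4\<close>, \<open>8\<close>, and so on.
  The original labelled cycle comes back after \<open>j\<close> rounds exactly if
  \<open>2\<^sup>j\<close> is congruent to \<open>1\<close> or \<open>-1\<close> modulo \<open>n\<close>.

  Now substitute \<open>G\<close> for one vertex of \<open>C\<^sub>n\<close>. Any two vertices of \<open>G\<close> then have a common
  neighbour on the cycle, so the metamour operation complements \<open>G\<close> while it doubles the step
  of the surrounding cycle (\<open>metamour_blown_up_circulant\<close>). After an even number \<open>k\<close> of rounds
  \<open>G\<close> is restored, so the substituted cycle has metamour period \<open>k\<close> as soon as \<open>k\<close> is the first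
  positive exponent with \<open>2\<^sup>k\<close> congruent to \<open>1\<close> or \<open>-1\<close> modulo \<open>n\<close>
  (\<open>has_metamour_period_blown_up_circulant\<close>).

  The modulus \<open>n = 5\<close> does this for \<open>k = 2\<close>, and the modulus \<open>n = 2\<^sup>k - 1\<close> for \<open>k \<ge> 4\<close>.
  The construction adds \<open>n - 1\<close> vertices to \<open>G\<close>, which gives the claimed orders.
\<close>

section \<open>Vertices at distance two\<close>

text \<open>
  With unit weights, the distance is the least length of a walk. It is 2 iff there is a walk
  of length 2 and none of length 0 or 1.
\<close>
lemma (in pair_wf_digraph) graph_dist_eq_2_iff:
  "graph_dist G u v = 2 \<longleftrightarrow>
    u \<noteq> v \<and> (u, v) \<notin> parcs G \<and> (\<exists>w. (u, w) \<in> parcs G \<and> (w, v) \<in> parcs G)"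
proof -
  have cost: "awalk_cost (\<lambda>_. 1) p = real (length p)" for p
    by (induction p) auto
  have dist: "graph_dist G u v = (INF p\<in>{p. awalk u p v}. ereal (real (length p)))"
    unfolding graph_dist_def \<mu>_def by (simp add: cost)
  have walk2: "(\<exists>p. awalk u p v \<and> length p = 2) \<longleftrightarrow>
      (\<exists>w. (u, w) \<in> parcs G \<and> (w, v) \<in> parcs G)" (is "?W \<longleftrightarrow> ?N")
  proof
    assume ?W
    then obtain a b where "awalk u [a, b] v"
      by (auto simp: length_Suc_conv numeral_2_eq_2)
    then show ?N
      by (cases a, cases b) (auto simp: awalk_simps)
  next
    assume ?N
    then obtain w where "(u, w) \<in> parcs G" "(w, v) \<in> parcs G" by blast
    then have "awalk u [(u, w), (w, v)] v"
      by (auto simp: awalk_simps in_arcsD2)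
    then show ?W by (intro exI[of _ "[(u, w), (w, v)]"]) simp
  qed
  have short: "(\<exists>p. awalk u p v \<and> length p < 2) \<longleftrightarrow>
      (u = v \<and> u \<in> pverts G) \<or> (u, v) \<in> parcs G" (is "?W \<longleftrightarrow> ?N")
  proof
    assume ?W
    then obtain p where p: "awalk u p v" "length p < 2" by blast
    then show ?N
      by (cases p) (auto simp: awalk_simps)
  next
    assume ?N
    then have "awalk u [] v \<or> awalk u [(u, v)] v"
      by (auto simp: awalk_simps in_arcsD2)
    then show ?W
      by (elim disjE) (force intro: exI[of _ "[]"] exI[of _ "[(u, v)]"])+
  qed
  have low: "ereal (real m) \<le> graph_dist G u v"
    if "\<And>p. awalk u p v \<Longrightarrow> m \<le> length p" for m
    unfolding dist by (rule INF_greatest) (use that in auto)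
  have up: "graph_dist G u v \<le> ereal (real (length p))" if "awalk u p v" for p
    unfolding dist by (rule INF_lower) (use that in auto)
  show ?thesis
  proof
    assume d: "graph_dist G u v = 2"
    have long: "2 \<le> length p" if "awalk u p v" for p
      using up[OF that] d by simp
    have "\<exists>p. awalk u p v \<and> length p = 2"
    proof (rule ccontr)
      assume "\<not> ?thesis"
      with long have "3 \<le> length p" if "awalk u p v" for p
        using that by (metis Suc_leI eval_nat_numeral(3) le_neq_implies_less)
      from low[OF this] d show False by simp
    qed
    with walk2 obtain w where w: "(u, w) \<in> parcs G" "(w, v) \<in> parcs G" by blast
    have "\<not> (\<exists>p. awalk u p v \<and> length p < 2)" using long by fastforce
    with short w show "u \<noteq> v \<and> (u, v) \<notin> parcs G \<and>
        (\<exists>w. (u, w) \<in> parcs G \<and> (w, v) \<in> parcs G)"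
      by (auto dest: in_arcsD1)
  next
    assume r: "u \<noteq> v \<and> (u, v) \<notin> parcs G \<and> (\<exists>w. (u, w) \<in> parcs G \<and> (w, v) \<in> parcs G)"
    with walk2 obtain p where "awalk u p v" "length p = 2" by blast
    with up[of p] have "graph_dist G u v \<le> 2" by simp
    moreover have "2 \<le> length p" if "awalk u p v" for p
      using r short that by (meson not_le)
    from low[OF this] have "2 \<le> graph_dist G u v" by simp
    ultimately show "graph_dist G u v = 2" by (rule antisym)
  qed
qed

lemma (in pair_graph) parcs_simple:
  shows "parcs G \<subseteq> pverts G \<times> pverts G" and "sym (parcs G)" and "irrefl (parcs G)"
proof -
  show "parcs G \<subseteq> pverts G \<times> pverts G" by (auto dest: in_arcsD1 in_arcsD2)
  show "sym (parcs G)" using pair_sym_arcs by (simp add: symmetric_def)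
  show "irrefl (parcs G)" using pair_no_loops by (force simp: irrefl_def)
qed

section \<open>Complements\<close>

definition complement_arcs :: "'a set \<Rightarrow> 'a rel \<Rightarrow> 'a rel" where
  "complement_arcs V E = {(x, y). x \<in> V \<and> y \<in> V \<and> x \<noteq> y \<and> (x, y) \<notin> E}"

lemma complement_arcs_complement_arcs:
  assumes "E \<subseteq> V \<times> V" "irrefl E"
  shows "complement_arcs V (complement_arcs V E) = E"
  using assms by (auto simp: complement_arcs_def irrefl_def)

lemma sym_complement_arcs: "sym E \<Longrightarrow> sym (complement_arcs V E)"
  by (auto simp: complement_arcs_def sym_def)

lemma irrefl_complement_arcs: "irrefl (complement_arcs V E)"
  by (auto simp: complement_arcs_def irrefl_def)

lemma complement_arcs_subset: "complement_arcs V E \<subseteq> V \<times> V"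
  by (auto simp: complement_arcs_def)

section \<open>Circulant graphs with one vertex replaced by a graph\<close>

text \<open>
  The vertices \<open>Inl x\<close> are those of the substituted graph, all sitting at position 0 of the
  cycle; the vertices \<open>Inr i\<close> with \<open>0 < i < n\<close> are the remaining positions.
\<close>
definition place :: "'a + nat \<Rightarrow> int" where
  "place u = (case u of Inl _ \<Rightarrow> 0 | Inr i \<Rightarrow> int i)"

lemma place_simps [simp]: "place (Inl x) = 0" "place (Inr i) = int i"
  by (simp_all add: place_def)

definition differ_by :: "nat \<Rightarrow> int \<Rightarrow> int \<Rightarrow> int \<Rightarrow> bool" where
  "differ_by n s a b \<longleftrightarrow> int n dvd a - b - s \<or> int n dvd a - b + s"

lemma differ_by_commute: "differ_by n s a b \<longleftrightarrow> differ_by n s b a"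
proof -
  have "b - a - s = - (a - b + s)" "b - a + s = - (a - b - s)" by auto
  then show ?thesis unfolding differ_by_def by (metis dvd_minus_iff)
qed

lemma differ_by_self: "differ_by n s a a \<longleftrightarrow> int n dvd s"
  by (simp add: differ_by_def)

lemma differ_by_compose:
  assumes "differ_by n s a b" "differ_by n s b c"
  shows "differ_by n (2 * s) a c \<or> int n dvd a - c"
proof -
  have sum: "int n dvd (a - b + e) + (b - c + e')"
    if "int n dvd a - b + e" "int n dvd b - c + e'" for e e'
    using that by (rule dvd_add)
  have "int n dvd a - c - 2 * s \<or> int n dvd a - c + 2 * s \<or> int n dvd a - c"
    using assms sum[of s s] sum[of s "- s"] sum[of "- s" s] sum[of "- s" "- s"]
    unfolding differ_by_def by (auto simp: algebra_simps)
  then show ?thesis by (auto simp: differ_by_def)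
qed

text \<open>
  This is the circulant graph on the integers modulo \<open>n\<close> with steps \<open>s\<close> and \<open>-s\<close>, in which the
  vertex 0 is replaced by the graph \<open>(V, E)\<close>: every vertex of \<open>V\<close> inherits the neighbours of 0.
\<close>
definition blown_up_circulant :: "nat \<Rightarrow> int \<Rightarrow> 'a set \<Rightarrow> 'a rel \<Rightarrow> ('a + nat) pair_pre_digraph" where
  "blown_up_circulant n s V E =
    \<lparr> pverts = V <+> {1..<n},
      parcs = {(u, v). u \<in> V <+> {1..<n} \<and> v \<in> V <+> {1..<n} \<and>
        ((\<exists>x y. u = Inl x \<and> v = Inl y \<and> (x, y) \<in> E) \<or> differ_by n s (place u) (place v))} \<rparr>"

lemma pverts_blown_up_circulant [simp]:
  "pverts (blown_up_circulant n s V E) = V <+> {1..<n}"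
  by (simp add: blown_up_circulant_def)

lemma parcs_blown_up_circulant:
  "(u, v) \<in> parcs (blown_up_circulant n s V E) \<longleftrightarrow>
    u \<in> V <+> {1..<n} \<and> v \<in> V <+> {1..<n} \<and>
    ((\<exists>x y. u = Inl x \<and> v = Inl y \<and> (x, y) \<in> E) \<or> differ_by n s (place u) (place v))"
  by (simp add: blown_up_circulant_def)

lemma congruent_places_imp:
  assumes "u \<in> V <+> {1..<n}" "v \<in> V <+> {1..<n}" "int n dvd place u - place v"
  shows "u = v \<or> (\<exists>x y. u = Inl x \<and> v = Inl y)"
proof -
  have "0 \<le> place u" "place u < int n \<or> (\<exists>x. u = Inl x)"
       "0 \<le> place v" "place v < int n \<or> (\<exists>x. v = Inl x)"
    using assms(1,2) by (auto simp: Plus_def)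
  then have "place u = place v"
  proof (cases "n = 0")
    case False
    then have "\<bar>place u - place v\<bar> < int n"
      using assms(1,2) by (auto simp: Plus_def)
    with assms(3) show ?thesis using dvd_imp_le_int[of "place u - place v" "int n"] by force
  qed (use assms in auto)
  then show ?thesis using assms(1,2) by (auto simp: Plus_def)
qed

lemma ex_vertex_at_place:
  assumes "V \<noteq> {}" "n > 0"
  obtains w where "w \<in> V <+> {1..<n}" "int n dvd place w - a"
proof -
  define r where "r = a mod int n"
  have r: "0 \<le> r" "r < int n" "int n dvd r - a"
    using assms(2) by (auto simp: r_def) (metis mod_0_imp_dvd mod_diff_left_eq diff_self mod_0)
  show ?thesis
  proof (cases "r = 0")
    case True
    then show ?thesis using assms(1) r that[of "Inl (SOME x. x \<in> V)"]
      by (auto simp: Plus_def some_in_eq)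
  next
    case False
    then show ?thesis using r that[of "Inr (nat r)"] by (auto simp: Plus_def nat_less_iff)
  qed
qed

text \<open>
  If \<open>n\<close> divides \<open>s\<close>, then every outer vertex has a loop; otherwise the circulant part has none.
\<close>
lemma pair_graph_blown_up_circulant:
  assumes "finite V" "E \<subseteq> V \<times> V" "sym E" "irrefl E" "\<not> int n dvd s"
  shows "pair_graph (blown_up_circulant n s V E)"
proof -
  let ?G = "blown_up_circulant n s V E"
  have fin: "finite (V <+> {1..<n})" using assms(1) by simp
  have sub: "parcs ?G \<subseteq> (V <+> {1..<n}) \<times> (V <+> {1..<n})"
    by (auto simp: parcs_blown_up_circulant)
  show ?thesis
  proof
    show "fst e \<in> pverts ?G" "snd e \<in> pverts ?G" if "e \<in> parcs ?G" for e
      using subsetD[OF sub that] by (auto simp: mem_Times_iff)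
    show "finite (pverts ?G)" using fin by simp
    show "finite (parcs ?G)" using fin sub by (meson finite_SigmaI finite_subset)
    show "fst e \<noteq> snd e" if "e \<in> parcs ?G" for e
      using that assms(4,5)
      by (cases e) (auto simp: parcs_blown_up_circulant irrefl_def differ_by_self)
    show "symmetric (with_proj ?G)"
      using assms(3) unfolding symmetric_def with_proj_simps
      by (intro symI) (auto simp: parcs_blown_up_circulant differ_by_commute dest: symD)
  qed
qed

text \<open>
  Two vertices of \<open>V\<close> always have the common neighbour at position \<open>s\<close>, so between them the
  relation is complemented. For any other pair, a path of length 2 changes the position by
  \<open>2 * s\<close>, \<open>-2 * s\<close> or \<open>0\<close>, and \<open>0\<close> is excluded for distinct vertices; conversely,
  positions that differ by \<open>2 * s\<close> have a midpoint. The steps \<open>s\<close> and \<open>2 * s\<close> never compete,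
  because an odd \<open>n \<ge> 5\<close> coprime to \<open>s\<close> divides none of \<open>s\<close>, \<open>2 * s\<close> and \<open>3 * s\<close>.
\<close>
lemma metamour_blown_up_circulant:
  assumes V: "V \<noteq> {}" "finite V" and E: "E \<subseteq> V \<times> V" "sym E" "irrefl E"
    and n: "odd n" "n \<ge> 5" and s: "coprime (int n) s"
  shows "metamour (blown_up_circulant n s V E) = blown_up_circulant n (2 * s) V (complement_arcs V E)"
proof -
  let ?G = "blown_up_circulant n s V E"
  let ?H = "blown_up_circulant n (2 * s) V (complement_arcs V E)"
  let ?W = "V <+> {1..<n}"
  have cancel: "int n dvd c" if "int n dvd c * s" for c
    using that s by (simp add: coprime_dvd_mult_left_iff)
  have n1: "\<not> int n dvd s" using cancel[of 1] n(2) by auto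
  have n2: "\<not> int n dvd 2 * s" using cancel[of 2] n(2) zdvd_imp_le[of "int n" 2] by auto
  have n3: "\<not> int n dvd 3 * s" using cancel[of 3] n(2) zdvd_imp_le[of "int n" 3] by auto
  interpret G: pair_graph ?G
    using pair_graph_blown_up_circulant[OF V(2) E n1] .
  have "u \<noteq> v \<and> (u, v) \<notin> parcs ?G \<and> (\<exists>w. (u, w) \<in> parcs ?G \<and> (w, v) \<in> parcs ?G)
      \<longleftrightarrow> (u, v) \<in> parcs ?H" (is "?L \<longleftrightarrow> ?R") if uv: "u \<in> ?W" "v \<in> ?W" for u v
  proof (cases "\<exists>x y. u = Inl x \<and> v = Inl y")
    case True
    then obtain x y where xy: "u = Inl x" "v = Inl y" by blast
    obtain w where w: "w \<in> ?W" "int n dvd place w - s"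
      using ex_vertex_at_place[OF V(1), of n s] n by auto
    then have "differ_by n s 0 (place w)" "differ_by n s (place w) 0"
      by (auto simp: differ_by_def) (metis dvd_minus_iff minus_diff_eq uminus_add_conv_diff)
    with w uv xy have "(u, w) \<in> parcs ?G" "(w, v) \<in> parcs ?G"
      by (auto simp: parcs_blown_up_circulant)
    then show ?thesis
      using uv xy n1 n2
      by (auto simp: parcs_blown_up_circulant complement_arcs_def differ_by_self)
  next
    case False
    then have ne: "u \<noteq> v \<longleftrightarrow> \<not> int n dvd place u - place v"
      using congruent_places_imp[OF uv] by auto
    have R: "?R \<longleftrightarrow> differ_by n (2 * s) (place u) (place v)"
      using uv False by (auto simp: parcs_blown_up_circulant)
    have A: "(u, v) \<in> parcs ?G \<longleftrightarrow> differ_by n s (place u) (place v)"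
      using uv False by (auto simp: parcs_blown_up_circulant)
    show ?thesis
    proof
      assume ?L
      then obtain w where w: "(u, w) \<in> parcs ?G" "(w, v) \<in> parcs ?G"
        and neq: "u \<noteq> v" and nonadj: "(u, v) \<notin> parcs ?G" by blast
      have uw: "differ_by n s (place u) (place w) \<or> (\<exists>x. u = Inl x) \<and> place u = place w"
        using w(1) by (auto simp: parcs_blown_up_circulant)
      have wv: "differ_by n s (place w) (place v) \<or> (\<exists>y. v = Inl y) \<and> place w = place v"
        using w(2) by (auto simp: parcs_blown_up_circulant)
      \<comment> \<open>A step inside \<open>E\<close> keeps the position, so \<open>u\<close> and \<open>v\<close> would already be adjacent.\<close>
      have "differ_by n s (place u) (place w)" "differ_by n s (place w) (place v)"
        using uw wv nonadj A False by metis+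
      then have "differ_by n (2 * s) (place u) (place v) \<or> int n dvd place u - place v"
        by (rule differ_by_compose)
      with neq ne R show ?R by blast
    next
      assume ?R
      then have d: "int n dvd place u - place v - 2 * s \<or> int n dvd place u - place v + 2 * s"
        using R by (simp add: differ_by_def)
      \<comment> \<open>Choosing the sign of the step once leaves a single case.\<close>
      obtain e where e: "e = s \<or> e = - s" "int n dvd place u - place v - 2 * e"
        using d by (metis diff_minus_eq_add mult_minus_right)
      have e2: "\<not> int n dvd 2 * e" and e3: "\<not> int n dvd 3 * e" and e1: "\<not> int n dvd e"
        using e(1) n1 n2 n3 by auto
      have "u \<noteq> v" using e(2) e2 by auto
      have "\<not> differ_by n s (place u) (place v)"
      proof
        assume "differ_by n s (place u) (place v)"
        then have "int n dvd place u - place v - e \<or> int n dvd place u - place v + e"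
          using e(1) by (auto simp: differ_by_def)
        then show False
          using dvd_diff[OF _ e(2)] e1 e3 by fastforce
      qed
      moreover obtain w where w: "w \<in> ?W" "int n dvd place w - (place v + e)"
        using ex_vertex_at_place[OF V(1), of n "place v + e"] n by auto
      have "differ_by n s (place w) (place v)"
        using w(2) e(1) by (auto simp: differ_by_def algebra_simps)
      moreover have "int n dvd place u - place w - e"
        using dvd_diff[OF e(2) w(2)] by (simp add: algebra_simps)
      then have "differ_by n s (place u) (place w)"
        using e(1) by (auto simp: differ_by_def)
      ultimately show ?L
        using \<open>u \<noteq> v\<close> A uv w(1) by (auto simp: parcs_blown_up_circulant)
    qed
  qed
  then have dist: "graph_dist ?G u v = 2 \<longleftrightarrow> (u, v) \<in> parcs ?H"
    if "u \<in> ?W" "v \<in> ?W" for u v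
    unfolding G.graph_dist_eq_2_iff using that by blast
  have "parcs (metamour ?G) = parcs ?H"
  proof (rule set_eqI)
    fix e :: "('a + nat) \<times> ('a + nat)"
    obtain u v where e: "e = (u, v)" by fastforce
    have "e \<in> parcs (metamour ?G) \<longleftrightarrow> u \<in> ?W \<and> v \<in> ?W \<and> graph_dist ?G u v = 2"
      by (simp add: metamour_def e)
    also have "\<dots> \<longleftrightarrow> u \<in> ?W \<and> v \<in> ?W \<and> (u, v) \<in> parcs ?H"
      using dist by blast
    also have "\<dots> \<longleftrightarrow> e \<in> parcs ?H"
      unfolding e parcs_blown_up_circulant by blast
    finally show "e \<in> parcs (metamour ?G) \<longleftrightarrow> e \<in> parcs ?H" .
  qed
  moreover have "pverts (metamour ?G) = pverts ?H"
    by (simp add: metamour_def)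
  ultimately show ?thesis by simp
qed

lemma funpow_metamour_blown_up_circulant:
  assumes V: "V \<noteq> {}" "finite V" and E: "E \<subseteq> V \<times> V" "sym E" "irrefl E"
    and n: "odd n" "n \<ge> 5"
  shows "(metamour ^^ j) (blown_up_circulant n 1 V E) =
    blown_up_circulant n (2 ^ j) V (if even j then E else complement_arcs V E)"
proof (induction j)
  case (Suc j)
  have cop: "coprime (int n) (2 ^ j)" using n(1) by simp
  let ?F = "if even j then E else complement_arcs V E"
  have F: "?F \<subseteq> V \<times> V" "sym ?F" "irrefl ?F"
    using E by (simp_all add: complement_arcs_subset sym_complement_arcs irrefl_complement_arcs)
  show ?case
    using Suc metamour_blown_up_circulant[OF V F n cop] complement_arcs_complement_arcs[OF E(1,3)]
    by (auto split: if_splits)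
qed simp

section \<open>The induced copy of the substituted graph\<close>

lemma embeds_blown_up_circulant:
  assumes G: "pair_graph G" and n: "\<not> int n dvd s"
  shows "embeds_as_induced_subgraph G (blown_up_circulant n s (pverts G) (parcs G))"
proof -
  interpret G: pair_graph G by fact
  let ?V = "pverts G"
  let ?B = "blown_up_circulant n s ?V (parcs G)"
  note arcs = G.parcs_simple
  interpret B: pair_graph ?B
    using pair_graph_blown_up_circulant[OF G.pair_finite_verts arcs n] .
  define f :: "('a, 'a \<times> 'a, 'a + nat, ('a + nat) \<times> ('a + nat)) digraph_isomorphism"
    where "f = \<lparr> iso_verts = Inl, iso_arcs = map_prod Inl Inl, iso_head = snd, iso_tail = fst \<rparr>"
  have iso: "pre_digraph.digraph_isomorphism (with_proj G) f"
    unfolding pre_digraph.digraph_isomorphism_def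
    using G.wf_digraph_axioms by (auto simp: f_def inj_on_def)
  define H where "H = app_iso f (with_proj G)"
  have wf: "wf_digraph H"
    unfolding H_def by (rule G.wf_digraphI_app_iso[OF iso])
  have "arcs H = {e \<in> parcs ?B. fst e \<in> verts H \<and> snd e \<in> verts H}"
    using arcs(1) n
    by (auto simp: H_def f_def parcs_blown_up_circulant differ_by_self
        intro: rev_image_eqI)
  then have "induced_subgraph H (with_proj ?B)"
    using wf B.wf_digraph_axioms
    by (auto simp: induced_subgraph_def subgraph_def compatible_def H_def f_def)
  then show ?thesis
    unfolding embeds_as_induced_subgraph_def digraph_iso_def using iso H_def by blast
qed

section \<open>The metamour period\<close>

text \<open>
  The outer cycle alone witnesses that no earlier iterate equals the original graph: positions 1
  and 2 are joined at the start, but by the step \<open>2\<^sup>j\<close> only if \<open>2\<^sup>j\<close> is congruent to \<open>1\<close> or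
  \<open>-1\<close>. At \<open>j = k\<close> the step agrees with 1 up to sign, and evenness of \<open>k\<close> restores \<open>E\<close>.
\<close>
lemma has_metamour_period_blown_up_circulant:
  assumes V: "V \<noteq> {}" "finite V" and E: "E \<subseteq> V \<times> V" "sym E" "irrefl E"
    and n: "odd n" "n \<ge> 5" and k: "k > 0" "even k"
    and returns: "int n dvd 2 ^ k - 1 \<or> int n dvd 2 ^ k + 1"
    and first: "\<And>j. 0 < j \<Longrightarrow> j < k \<Longrightarrow> \<not> int n dvd 2 ^ j - 1 \<and> \<not> int n dvd 2 ^ j + 1"
  shows "has_metamour_period (blown_up_circulant n 1 V E) k"
proof -
  let ?G = "blown_up_circulant n 1 V E"
  note pow = funpow_metamour_blown_up_circulant[OF V E n]
  have "differ_by n (2 ^ k) a b \<longleftrightarrow> differ_by n 1 a b" for a b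
  proof -
    obtain e :: int where e: "e = 1 \<or> e = - 1" "int n dvd 2 ^ k - e"
      using returns by fastforce
    have "a - b - e = (a - b - 2 ^ k) + (2 ^ k - e)" by simp
    then have "int n dvd a - b - 2 ^ k \<longleftrightarrow> int n dvd a - b - e"
      using dvd_add_left_iff[OF e(2)] by metis
    moreover have "int n dvd a - b + 2 ^ k \<longleftrightarrow> int n dvd a - b + e"
      using dvd_add_left_iff[OF e(2), of "a - b + e"] by (simp add: algebra_simps)
    ultimately show ?thesis using e(1) by (auto simp: differ_by_def)
  qed
  then have "(metamour ^^ k) ?G = ?G"
    unfolding pow using k by (simp add: blown_up_circulant_def)
  moreover have "(metamour ^^ j) ?G \<noteq> ?G" if j: "0 < j" "j < k" for j
  proof
    assume eq: "(metamour ^^ j) ?G = ?G"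
    have mem: "(Inr 2, Inr 1) \<in> parcs (blown_up_circulant n s V F)
        \<longleftrightarrow> int n dvd 1 - s \<or> int n dvd 1 + s" for s F
      using n(2) by (auto simp: parcs_blown_up_circulant differ_by_def Plus_def)
    have "(Inr 2, Inr 1) \<in> parcs ?G" unfolding mem by simp
    then have "(Inr 2, Inr 1) \<in> parcs ((metamour ^^ j) ?G)" by (simp only: eq)
    then have "int n dvd 1 - 2 ^ j \<or> int n dvd 1 + 2 ^ j" by (simp only: pow mem)
    with first[OF j] show False by (metis add.commute dvd_diff_commute)
  qed
  ultimately show ?thesis using k by (simp add: has_metamour_period_def)
qed

text \<open>
  Both numbers are positive and smaller than the modulus. For \<open>k = 2\<close> the second claim fails at
  \<open>j = 1\<close>, since \<open>3\<close> divides \<open>2 + 1\<close>; hence the other modulus for period 2.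
\<close>
lemma small_powers_of_2_mod_Mersenne:
  assumes "0 < j" "j < k" "k \<ge> 3"
  shows "\<not> (2 ^ k - 1 :: int) dvd 2 ^ j - 1" "\<not> (2 ^ k - 1 :: int) dvd 2 ^ j + 1"
proof -
  have "2 * (2::int) ^ j = 2 ^ Suc j" by simp
  also have "\<dots> \<le> 2 ^ k" using assms by (intro power_increasing) auto
  finally have le: "2 * (2::int) ^ j \<le> 2 ^ k" .
  have "(2::int) ^ 3 \<le> 2 ^ k" using assms by (intro power_increasing) auto
  moreover have "(2::int) ^ 1 \<le> 2 ^ j" using assms by (intro power_increasing) auto
  ultimately show "\<not> (2 ^ k - 1 :: int) dvd 2 ^ j - 1" "\<not> (2 ^ k - 1 :: int) dvd 2 ^ j + 1"
    using le by (auto dest!: zdvd_imp_le)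
qed

theorem theorem5p6:
  fixes G :: "'a pair_pre_digraph" and k :: nat
  assumes "pair_graph G" and "pverts G \<noteq> {}"
    and "k > 0" and "even k"
  shows "\<exists>G' :: ('a + nat) pair_pre_digraph.
    pair_graph G' \<and> pverts G' \<noteq> {} \<and>
    embeds_as_induced_subgraph G G' \<and>
    has_metamour_period G' k \<and>
    (k = 2 \<longrightarrow> card (pverts G') = card (pverts G) + 4) \<and>
    (k \<ge> 4 \<longrightarrow> card (pverts G') = card (pverts G) + (2 ^ k - 2))"
proof -
  interpret G: pair_graph G by fact
  let ?V = "pverts G"
  define n :: nat where "n = (if k = 2 then 5 else 2 ^ k - 1)"
  define G' where "G' = blown_up_circulant n 1 ?V (parcs G)"
  have k4: "k \<ge> 4" if "k \<noteq> 2"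
  proof -
    have "k \<noteq> 1" "k \<noteq> 3" using assms(4) by auto
    with assms(3) that show ?thesis by linarith
  qed
  have big: "(16::nat) \<le> 2 ^ k" if "k \<noteq> 2"
    using power_increasing[OF k4[OF that], of "2::nat"] by simp
  have n: "odd n" "n \<ge> 5"
    using assms(3) big by (auto simp: n_def)
  have int_n: "int n = 2 ^ k - 1" if "k \<noteq> 2"
    using that by (simp add: n_def of_nat_diff)
  note arcs = G.parcs_simple
  have n1: "\<not> int n dvd 1" using n by auto
  have "pair_graph G'"
    unfolding G'_def
    using pair_graph_blown_up_circulant[OF G.pair_finite_verts arcs n1] .
  moreover have "pverts G' \<noteq> {}" using assms(2) by (auto simp: G'_def)
  moreover have "embeds_as_induced_subgraph G G'"
    unfolding G'_def by (rule embeds_blown_up_circulant[OF assms(1) n1])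
  moreover have "has_metamour_period G' k"
    unfolding G'_def
  proof (rule has_metamour_period_blown_up_circulant
      [OF assms(2) G.pair_finite_verts arcs n assms(3,4)])
    show "int n dvd 2 ^ k - 1 \<or> int n dvd 2 ^ k + 1"
      using int_n by (cases "k = 2") (auto simp: n_def)
    show "\<not> int n dvd 2 ^ j - 1 \<and> \<not> int n dvd 2 ^ j + 1" if j: "0 < j" "j < k" for j
    proof (cases "k = 2")
      case True
      with j have "j = 1" by simp
      with True show ?thesis by (simp add: n_def)
    next
      case False
      with small_powers_of_2_mod_Mersenne[OF j] k4 int_n show ?thesis by simp
    qed
  qed
  moreover have "card (pverts G') = card ?V + (n - 1)"
    using G.pair_finite_verts by (simp add: G'_def card_Plus)
  then have "k = 2 \<longrightarrow> card (pverts G') = card ?V + 4"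
    "k \<ge> 4 \<longrightarrow> card (pverts G') = card ?V + (2 ^ k - 2)"
    by (auto simp: n_def)
  ultimately show ?thesis by blast
qed

end
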